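(* Let $R$ be an $\mathscr{H}$-semicommutative ring. Then $R$ is abelian, and for any idempotent $e=e^{2}\in R$ the rings $eR$ and $(1-e)R$ are $\mathscr{H}$-semicommutative.
   Context: Rings are associative with unity (unless the ring is a nil ring). For a ring $R$, the hypercenter is $T(R)=\{a\in R : \text{for every } x\in R \text{ there is } n=n(x,a)\geq 1 \text{ with } ax^{n}=x^{n}a\}$; it is a subring of $R$ containing the center. A ring $R$ is called $\mathscr{H}$-semicommutative if for all $u,v\in R$, $uv=0$ implies $uRv\subseteq T(R)$. A ring is abelian if every idempotent is central. *)

theory Defs
  imports "HOL-Algebra.Ring" "HOL-Algebra.Coset"
begin

definition hypercenter :: "('a, 'm) ring_scheme \<Rightarrow> 'a set" where
  "hypercenter R =
     {a \<in> carrier R. \<forall>x \<in> carrier R. \<exists>n::nat. n \<ge> 1 \<and>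
        a \<otimes>\<^bsub>R\<^esub> (x [^]\<^bsub>R\<^esub> n) = (x [^]\<^bsub>R\<^esub> n) \<otimes>\<^bsub>R\<^esub> a}"

definition H_semicommutative :: "('a, 'm) ring_scheme \<Rightarrow> bool" where
  "H_semicommutative R \<longleftrightarrow> ring R \<and>
     (\<forall>u \<in> carrier R. \<forall>v \<in> carrier R. u \<otimes>\<^bsub>R\<^esub> v = \<zero>\<^bsub>R\<^esub> \<longrightarrow>
        {u \<otimes>\<^bsub>R\<^esub> r \<otimes>\<^bsub>R\<^esub> v | r. r \<in> carrier R} \<subseteq> hypercenter R)"

definition idempotent_in :: "('a, 'm) ring_scheme \<Rightarrow> 'a \<Rightarrow> bool" where
  "idempotent_in R e \<longleftrightarrow> e \<in> carrier R \<and> e \<otimes>\<^bsub>R\<^esub> e = e"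

(* "Abelian" in the ring-theoretic sense; unrelated to commutativity of
   addition or multiplication. *)
definition abelian_ring :: "('a, 'm) ring_scheme \<Rightarrow> bool" where
  "abelian_ring R \<longleftrightarrow> ring R \<and>
     (\<forall>e. idempotent_in R e \<longrightarrow> (\<forall>x \<in> carrier R. e \<otimes>\<^bsub>R\<^esub> x = x \<otimes>\<^bsub>R\<^esub> e))"

(* eR with the operations inherited from R and with e as its identity. For a
   non-central idempotent e this record need not satisfy the axioms of a ring. *)
definition idempotent_ring :: "('a, 'm) ring_scheme \<Rightarrow> 'a \<Rightarrow> ('a, 'm) ring_scheme" where
  "idempotent_ring R e = R\<lparr>carrier := e <#\<^bsub>R\<^esub> carrier R, one := e\<rparr>"

end

theory Submission
  imports Defs
begin

text \<open>For an idempotent \<open>e\<close>, both \<open>eR(1 - e)\<close> and \<open>(1 - e)Re\<close> lie in the hypercenter, because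
  \<open>e(1 - e) = (1 - e)e = 0\<close>. Every power of \<open>e\<close> is \<open>e\<close>, so their elements commute with \<open>e\<close> and
  therefore vanish. This gives \<open>er = ere = re\<close>. For the second claim, products and positive powers
  in \<open>eR\<close> are those of \<open>R\<close>, so hypercentral elements of \<open>R\<close> lying in \<open>eR\<close> are hypercentral there.\<close>

context ring
begin

text \<open>The exponent must be positive, since the zeroth power is \<open>\<one>\<close>; the
  induction therefore starts at 1.\<close>

lemma idempotent_pow:
  assumes "idempotent_in R e" "n \<ge> (1::nat)"
  shows "e [^] n = e"
  using assms(2)
proof (induction n rule: dec_induct)
  case base
  then show ?case using assms(1) by (simp add: idempotent_in_def)
next
  case (step n)
  then show ?case using assms(1) by (simp add: idempotent_in_def)
qed

lemma hypercenter_commutes_idempotent: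
  assumes "idempotent_in R e" "a \<in> hypercenter R"
  shows "a \<otimes> e = e \<otimes> a"
proof -
  have "e \<in> carrier R" using assms(1) by (simp add: idempotent_in_def)
  then obtain n :: nat where "n \<ge> 1" "a \<otimes> e [^] n = e [^] n \<otimes> a"
    using assms(2) unfolding hypercenter_def by blast
  then show ?thesis using idempotent_pow[OF assms(1)] by simp
qed

text \<open>The two vanishing products supply the pairs with uv = 0 to which H-semicommutativity is
  applied; idempotency of 1 - e reduces the claim about (1 - e)R to the one about eR.\<close>

lemma idempotent_complement:
  assumes "idempotent_in R e"
  shows "idempotent_in R (\<one> \<ominus> e)"
    and "e \<otimes> (\<one> \<ominus> e) = \<zero>" and "(\<one> \<ominus> e) \<otimes> e = \<zero>"
proof -
  have e: "e \<in> carrier R" "e \<otimes> e = e" using assms by (auto simp: idempotent_in_def)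
  show 1: "e \<otimes> (\<one> \<ominus> e) = \<zero>" and "(\<one> \<ominus> e) \<otimes> e = \<zero>"
    using e by (simp_all add: minus_eq l_distr r_distr l_minus r_minus r_neg)
  have "(\<one> \<ominus> e) \<otimes> (\<one> \<ominus> e) = \<one> \<otimes> (\<one> \<ominus> e) \<ominus> e \<otimes> (\<one> \<ominus> e)"
    using e by (simp add: minus_eq l_distr l_minus)
  also have "\<dots> = \<one> \<ominus> e" using e by (simp add: 1) (simp add: minus_eq)
  finally show "idempotent_in R (\<one> \<ominus> e)" using e by (simp add: idempotent_in_def)
qed

lemma H_semicommutative_idempotent_central:
  assumes H: "H_semicommutative R" and idem: "idempotent_in R e" and x: "x \<in> carrier R"
  shows "e \<otimes> x = x \<otimes> e"
proof -
  have e: "e \<in> carrier R" "e \<otimes> e = e" using idem by (auto simp: idempotent_in_def)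
  note f = idempotent_complement[OF idem]
  have f_carrier: "\<one> \<ominus> e \<in> carrier R" using e by simp
  have "e \<otimes> x \<otimes> (\<one> \<ominus> e) \<in> hypercenter R"
    using H e(1) f_carrier f(2) x unfolding H_semicommutative_def by blast
  \<comment> \<open>Multiplying ex(1 - e) by e on the right gives 0, as (1 - e)e = 0; on the left it
    changes nothing, as ee = e.\<close>
  from hypercenter_commutes_idempotent[OF idem this]
  have "e \<otimes> x \<otimes> (\<one> \<ominus> e) = \<zero>"
    using e x f f_carrier by (simp add: m_assoc) (simp add: m_assoc[symmetric])
  then have 1: "e \<otimes> x = e \<otimes> x \<otimes> e"
    using e x by (simp add: minus_eq r_distr r_minus) (auto dest: minus_equality)
  have "(\<one> \<ominus> e) \<otimes> x \<otimes> e \<in> hypercenter R"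
    using H e(1) f_carrier f(3) x unfolding H_semicommutative_def by blast
  \<comment> \<open>Here the sides are exchanged: e on the left annihilates (1 - e)xe, and e on the
    right fixes it.\<close>
  from hypercenter_commutes_idempotent[OF idem this]
  have "(\<one> \<ominus> e) \<otimes> x \<otimes> e = \<zero>"
    using e x f f_carrier by (simp add: m_assoc) (simp add: m_assoc[symmetric])
  then have "x \<otimes> e = e \<otimes> x \<otimes> e"
    using e x by (simp add: minus_eq l_distr l_minus) (auto dest: minus_equality)
  with 1 show ?thesis by simp
qed

text \<open>If x = er then ex = eer = er = x. Membership in eR thus becomes an equation, and closure
  properties can be checked by rewriting.\<close>

lemma idempotent_ring_carrier_iff:
  assumes "idempotent_in R e"
  shows "x \<in> carrier (idempotent_ring R e) \<longleftrightarrow> x \<in> carrier R \<and> e \<otimes> x = x"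
  using assms
  by (auto simp: idempotent_ring_def idempotent_in_def l_coset_def m_assoc[symmetric])
    metis

text \<open>Zeroth powers are the respective identities, e and \<open>\<one>\<close>, and may
  differ. First powers agree because they unfold to ex in eR and to
  \<open>\<one> \<otimes> x\<close> in R, both equal to x.\<close>

lemma idempotent_ring_pow:
  assumes "idempotent_in R e" "x \<in> carrier (idempotent_ring R e)" "n \<ge> (1::nat)"
  shows "x [^]\<^bsub>idempotent_ring R e\<^esub> n = x [^] n"
  using assms(3)
proof (induction n rule: dec_induct)
  case base
  then show ?case using assms(2) idempotent_ring_carrier_iff[OF assms(1)]
    by (simp add: nat_pow_def idempotent_ring_def)
next
  case (step n)
  then show ?case by (simp add: nat_pow_def idempotent_ring_def)
qed

lemma ring_idempotent_ring:
  assumes idem: "idempotent_in R e"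
    and central: "\<And>x. x \<in> carrier R \<Longrightarrow> e \<otimes> x = x \<otimes> e"
  shows "ring (idempotent_ring R e)"
proof -
  let ?S = "idempotent_ring R e"
  have e: "e \<in> carrier R" "e \<otimes> e = e" using idem by (auto simp: idempotent_in_def)
  note carr = idempotent_ring_carrier_iff[OF idem]
  have ops [simp]: "add ?S = add R" "mult ?S = mult R" "zero ?S = \<zero>" "one ?S = e"
    by (simp_all add: idempotent_ring_def)
  show ?thesis
  proof (rule ringI)
    show "abelian_group ?S"
    proof (rule abelian_groupI)
      fix x assume "x \<in> carrier ?S"
      then show "\<exists>y\<in>carrier ?S. y \<oplus>\<^bsub>?S\<^esub> x = \<zero>\<^bsub>?S\<^esub>"
        using e by (intro bexI[of _ "\<ominus> x"]) (auto simp: carr r_minus l_neg)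
    qed (use e in \<open>auto simp: carr r_distr a_ac\<close>)
    show "monoid ?S"
    proof (rule monoidI)
      \<comment> \<open>This is where centrality enters: elements of eR satisfy ex = x by
        membership, but xe = x needs xe = ex.\<close>
      fix x assume "x \<in> carrier ?S"
      then show "x \<otimes>\<^bsub>?S\<^esub> \<one>\<^bsub>?S\<^esub> = x" using central[of x] by (simp add: carr)
    qed (use e in \<open>auto simp: carr m_assoc m_assoc[of e, symmetric]\<close>)
  qed (use e in \<open>auto simp: carr l_distr r_distr\<close>)
qed

lemma H_semicommutative_idempotent_ring:
  assumes H: "H_semicommutative R" and idem: "idempotent_in R e"
  shows "H_semicommutative (idempotent_ring R e)"
proof -
  let ?S = "idempotent_ring R e"
  note carr = idempotent_ring_carrier_iff[OF idem]
  have ops: "mult ?S = mult R" "zero ?S = \<zero>"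
    by (simp_all add: idempotent_ring_def)
  have S: "ring ?S"
    using ring_idempotent_ring[OF idem] H_semicommutative_idempotent_central[OF H idem] by blast
  \<comment> \<open>Each test element of eR is also one of R, and the exponent found in R is
    kept.\<close>
  have hyper: "a \<in> hypercenter ?S" if "a \<in> hypercenter R" "a \<in> carrier ?S" for a
    unfolding hypercenter_def
  proof (intro CollectI conjI ballI)
    fix x assume x: "x \<in> carrier ?S"
    then obtain n :: nat where "n \<ge> 1" "a \<otimes> x [^] n = x [^] n \<otimes> a"
      using \<open>a \<in> hypercenter R\<close> carr unfolding hypercenter_def by blast
    then show "\<exists>n::nat. n \<ge> 1 \<and> a \<otimes>\<^bsub>?S\<^esub> x [^]\<^bsub>?S\<^esub> n = x [^]\<^bsub>?S\<^esub> n \<otimes>\<^bsub>?S\<^esub> a"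
      using idempotent_ring_pow[OF idem x] by (auto simp: ops)
  qed (fact that(2))
  show ?thesis
    unfolding H_semicommutative_def
  proof (intro conjI S ballI impI subsetI)
    fix u v a
    assume u: "u \<in> carrier ?S" and v: "v \<in> carrier ?S" and uv: "u \<otimes>\<^bsub>?S\<^esub> v = \<zero>\<^bsub>?S\<^esub>"
      and "a \<in> {u \<otimes>\<^bsub>?S\<^esub> r \<otimes>\<^bsub>?S\<^esub> v | r. r \<in> carrier ?S}"
    then obtain r where r: "r \<in> carrier ?S" and a: "a = u \<otimes>\<^bsub>?S\<^esub> r \<otimes>\<^bsub>?S\<^esub> v" by blast
    interpret S: ring ?S by (fact S)
    \<comment> \<open>Closure of eR under products puts urv in eR; the hypothesis on R, with r
      viewed in R, makes it hypercentral there.\<close>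
    have "a \<in> carrier ?S" using u v r a by simp
    moreover have "a \<in> hypercenter R"
      using H u v r uv a carr unfolding H_semicommutative_def ops by blast
    ultimately show "a \<in> hypercenter ?S" by (rule hyper[rotated])
  qed
qed

end

theorem proposition2p5:
  fixes R :: "('a, 'm) ring_scheme"
  assumes "H_semicommutative R"
  shows "abelian_ring R \<and>
    (\<forall>e. idempotent_in R e \<longrightarrow>
       H_semicommutative (idempotent_ring R e) \<and>
       H_semicommutative (idempotent_ring R (\<one>\<^bsub>R\<^esub> \<ominus>\<^bsub>R\<^esub> e)))"
proof -
  interpret ring R using assms by (simp add: H_semicommutative_def)
  show ?thesis
    \<comment> \<open>The claim for 1 - e is the claim for e applied to the complementary
      idempotent.\<close>
    using H_semicommutative_idempotent_central[OF assms] idempotent_complement(1)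
      H_semicommutative_idempotent_ring[OF assms] ring_axioms
    unfolding abelian_ring_def by blast
qed

end
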